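(* Let $n\ge1$ and let $t_n$ be the linear operator on $\mathbb{C}\mathfrak{S}_n$ given by $t_n(f)=f\tau_n$, where $$\tau_n=12\cdots n+2134\cdots n+3124\cdots n+\cdots+n12\cdots(n-1)\in\mathbb{C}\mathfrak{S}_n$$ (sum of the $n$ permutations obtained from the identity word by moving one letter to the front). Then $t_n$ is diagonalizable, its spectrum is $\{0,1,\dots,n-2\}\cup\{n\}$, and its minimal polynomial is $$P_n(x)=(x-n)\prod_{k=0}^{n-2}(x-k).$$ Moreover, under the identification of $\mathbf{Sym}_n$ with the descent algebra, $\tau_n$ corresponds to $T_n=S_1S_{n-1}$, and for each $k$ with $0\le k\le n$ the spectral projector of $t_n$ onto the eigenspace of eigenvalue $k$ (the zero operator if $k$ is not an eigenvalue) is right multiplication by the element corresponding to $D_{n,k}$, where the $D_{n,k}\in\mathbf{Sym}_n$ are given by the generating series $$\sum_{n\ge0}\sum_{k=0}^n t^{n-k}u^kD_{n,k}=e^{(u-t)S_1}\sum_{m\ge0}t^mS_m .$$ In particular the projector onto the kernel of $t_n$ corresponds to $D_n=D_{n,0}$, where $\sum_{n\ge0}D_nx^n=e^{-xS_1}\sum_{m\ge0}x^mS_m$.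
   Context: Permutations are written as words $\sigma_1\cdots\sigma_n$ with $\sigma_i=\sigma(i)$, and products are compositions $(\sigma\tau)(i)=\sigma(\tau(i))$. $\mathbf{Sym}=\bigoplus_n\mathbf{Sym}_n$ is the free associative unital $\mathbb{C}$-algebra on generators $S_1,S_2,\dots$, $\deg S_n=n$, $S_0=1$; for a composition $I=(i_1,\dots,i_r)$ of $n$, $S^I=S_{i_1}\cdots S_{i_r}$. The identification of $\mathbf{Sym}_n$ with Solomon's descent algebra (a subalgebra of $\mathbb{C}\mathfrak{S}_n$) is the linear map sending $S^I$ to the sum of all permutations $\sigma\in\mathfrak{S}_n$ whose descent set $\{i:\sigma_i>\sigma_{i+1}\}$ is contained in $\{i_1,i_1+i_2,\dots,i_1+\cdots+i_{r-1}\}$. (This operator describes the Tsetlin library Markov chain in the uniform case.) *)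

theory Defs
  imports
    Complex_Main
    "HOL-Library.Poly_Mapping"
    "HOL-Computational_Algebra.Polynomial"
    "HOL-Computational_Algebra.Formal_Power_Series"
    "HOL-Algebra.Sym_Groups"
begin

section \<open>Complex vector spaces of finitely supported functions\<close>

text \<open>The type \<^typ>\<open>'a \<Rightarrow>\<^sub>0 complex\<close> is the free complex vector space on \<^typ>\<open>'a\<close>,
  with \<^term>\<open>Poly_Mapping.single a 1\<close> as basis vectors.\<close>

definition scale :: "complex \<Rightarrow> ('a \<Rightarrow>\<^sub>0 complex) \<Rightarrow> ('a \<Rightarrow>\<^sub>0 complex)"
  where "scale c f = Poly_Mapping.map (\<lambda>x. c * x) f"

lemma lookup_scale [simp]: "Poly_Mapping.lookup (scale c f) a = c * Poly_Mapping.lookup f a"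
  by (simp add: scale_def map.rep_eq when_def)

global_interpretation free_vs: vector_space "scale :: complex \<Rightarrow> ('a \<Rightarrow>\<^sub>0 complex) \<Rightarrow> _"
  by unfold_locales (auto intro!: poly_mapping_eqI simp: lookup_add algebra_simps)


section \<open>Operators on a subspace\<close>

text \<open>An operator on a subspace \<open>V\<close> is given by a function on the whole type; only its values
  on \<open>V\<close> matter.\<close>

definition linear_op ::
  "('a \<Rightarrow>\<^sub>0 complex) set \<Rightarrow> (('a \<Rightarrow>\<^sub>0 complex) \<Rightarrow> ('a \<Rightarrow>\<^sub>0 complex)) \<Rightarrow> bool" where
  "linear_op V T \<longleftrightarrow> (\<forall>v\<in>V. T v \<in> V) \<and> (\<forall>v\<in>V. \<forall>w\<in>V. T (v + w) = T v + T w) \<and>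
     (\<forall>c. \<forall>v\<in>V. T (scale c v) = scale c (T v))"

definition eigenspace ::
  "('a \<Rightarrow>\<^sub>0 complex) set \<Rightarrow> (('a \<Rightarrow>\<^sub>0 complex) \<Rightarrow> ('a \<Rightarrow>\<^sub>0 complex)) \<Rightarrow> complex
     \<Rightarrow> ('a \<Rightarrow>\<^sub>0 complex) set" where
  "eigenspace V T c = {v \<in> V. T v = scale c v}"

definition spectrum ::
  "('a \<Rightarrow>\<^sub>0 complex) set \<Rightarrow> (('a \<Rightarrow>\<^sub>0 complex) \<Rightarrow> ('a \<Rightarrow>\<^sub>0 complex)) \<Rightarrow> complex set" where
  "spectrum V T = {c. \<exists>v \<in> eigenspace V T c. v \<noteq> 0}"

definition diagonalizable ::
  "('a \<Rightarrow>\<^sub>0 complex) set \<Rightarrow> (('a \<Rightarrow>\<^sub>0 complex) \<Rightarrow> ('a \<Rightarrow>\<^sub>0 complex)) \<Rightarrow> bool" where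
  "diagonalizable V T \<longleftrightarrow>
     (\<exists>B \<subseteq> V. free_vs.independent B \<and> free_vs.span B = V \<and> (\<forall>b\<in>B. \<exists>c. b \<in> eigenspace V T c))"

definition poly_op ::
  "complex poly \<Rightarrow> (('a \<Rightarrow>\<^sub>0 complex) \<Rightarrow> ('a \<Rightarrow>\<^sub>0 complex)) \<Rightarrow> ('a \<Rightarrow>\<^sub>0 complex) \<Rightarrow> ('a \<Rightarrow>\<^sub>0 complex)"
  where
  "poly_op p T v = (\<Sum>i\<le>Polynomial.degree p. scale (Polynomial.coeff p i) ((T ^^ i) v))"

definition minimal_polynomial ::
  "('a \<Rightarrow>\<^sub>0 complex) set \<Rightarrow> (('a \<Rightarrow>\<^sub>0 complex) \<Rightarrow> ('a \<Rightarrow>\<^sub>0 complex)) \<Rightarrow> complex poly \<Rightarrow> bool" where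
  "minimal_polynomial V T p \<longleftrightarrow> Polynomial.lead_coeff p = 1 \<and> (\<forall>v\<in>V. poly_op p T v = 0) \<and>
     (\<forall>q. (\<forall>v\<in>V. poly_op q T v = 0) \<longrightarrow> p dvd q)"

text \<open>The projection onto the eigenspace for \<open>c\<close> along the sum of all other eigenspaces. For
  a diagonalizable operator it exists and is unique on \<open>V\<close>; if \<open>c\<close> is not an eigenvalue, the
  image condition forces it to vanish on \<open>V\<close>.\<close>

definition spectral_projector ::
  "('a \<Rightarrow>\<^sub>0 complex) set \<Rightarrow> (('a \<Rightarrow>\<^sub>0 complex) \<Rightarrow> ('a \<Rightarrow>\<^sub>0 complex)) \<Rightarrow> complex
     \<Rightarrow> (('a \<Rightarrow>\<^sub>0 complex) \<Rightarrow> ('a \<Rightarrow>\<^sub>0 complex)) \<Rightarrow> bool" where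
  "spectral_projector V T c P \<longleftrightarrow> linear_op V P \<and> (\<forall>v\<in>V. P (P v) = P v) \<and>
     P ` V = eigenspace V T c \<and>
     {v \<in> V. P v = 0} = free_vs.span (\<Union>d\<in>- {c}. eigenspace V T d)"


section \<open>The group algebra of the symmetric group\<close>

definition group_algebra :: "('g, 'm) monoid_scheme \<Rightarrow> ('g \<Rightarrow>\<^sub>0 complex) set" where
  "group_algebra G = {f. Poly_Mapping.keys f \<subseteq> carrier G}"

definition conv ::
  "('g, 'm) monoid_scheme \<Rightarrow> ('g \<Rightarrow>\<^sub>0 complex) \<Rightarrow> ('g \<Rightarrow>\<^sub>0 complex) \<Rightarrow> ('g \<Rightarrow>\<^sub>0 complex)" where
  "conv G f g = (\<Sum>x\<in>Poly_Mapping.keys f. \<Sum>y\<in>Poly_Mapping.keys g.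
     Poly_Mapping.single (x \<otimes>\<^bsub>G\<^esub> y) (Poly_Mapping.lookup f x * Poly_Mapping.lookup g y))"

abbreviation CS :: "nat \<Rightarrow> ((nat \<Rightarrow> nat) \<Rightarrow>\<^sub>0 complex) set" where
  "CS n \<equiv> group_algebra (sym_group n)"

definition perm_of_word :: "nat list \<Rightarrow> nat \<Rightarrow> nat" where
  "perm_of_word w i = (if 1 \<le> i \<and> i \<le> length w then w ! (i - 1) else i)"

definition tau :: "nat \<Rightarrow> ((nat \<Rightarrow> nat) \<Rightarrow>\<^sub>0 complex)" where
  "tau n = (\<Sum>k\<in>{1..n}. Poly_Mapping.single (perm_of_word (k # remove1 k [1..<Suc n])) 1)"

definition t_op :: "nat \<Rightarrow> ((nat \<Rightarrow> nat) \<Rightarrow>\<^sub>0 complex) \<Rightarrow> ((nat \<Rightarrow> nat) \<Rightarrow>\<^sub>0 complex)" where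
  "t_op n f = conv (sym_group n) f (tau n)"


section \<open>Noncommutative symmetric functions\<close>

typedef composition = "{I :: nat list. \<forall>i\<in>set I. 0 < i}"
  by (rule exI[of _ "[]"]) simp

setup_lifting type_definition_composition

text \<open>The additive notation is the one \<^typ>\<open>'a \<Rightarrow>\<^sub>0 'b\<close> requires for its convolution product:
  with concatenation as addition, \<^typ>\<open>composition \<Rightarrow>\<^sub>0 complex\<close> is the monoid algebra of the
  free monoid on the positive integers, i.e. the free associative algebra.\<close>

instantiation composition :: monoid_add
begin

lift_definition zero_composition :: composition is "[]" by simp

lift_definition plus_composition :: "composition \<Rightarrow> composition \<Rightarrow> composition" is "(@)" by auto

instance by (standard; transfer; simp)

end

type_synonym sym = "composition \<Rightarrow>\<^sub>0 complex"

definition S :: "nat \<Rightarrow> sym" where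
  "S m = (if m = 0 then 1 else Poly_Mapping.single (Abs_composition [m]) 1)"

definition Sym :: "nat \<Rightarrow> sym set" where
  "Sym n = {F. \<forall>I\<in>Poly_Mapping.keys F. sum_list (Rep_composition I) = n}"

definition descent_set :: "nat \<Rightarrow> (nat \<Rightarrow> nat) \<Rightarrow> nat set" where
  "descent_set n p = {i. 1 \<le> i \<and> i < n \<and> p i > p (i + 1)}"

definition partial_sums :: "composition \<Rightarrow> nat set" where
  "partial_sums I =
     {sum_list (take j (Rep_composition I)) | j. 1 \<le> j \<and> j < length (Rep_composition I)}"

text \<open>Linear extension of the map on basis elements \<open>S\<^sup>I\<close>; meaningful on \<open>Sym n\<close> only.\<close>

definition to_descent_algebra :: "nat \<Rightarrow> sym \<Rightarrow> ((nat \<Rightarrow> nat) \<Rightarrow>\<^sub>0 complex)" where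
  "to_descent_algebra n F = (\<Sum>I\<in>Poly_Mapping.keys F. scale (Poly_Mapping.lookup F I)
     (\<Sum>p | p \<in> carrier (sym_group n) \<and> descent_set n p \<subseteq> partial_sums I.
        Poly_Mapping.single p 1))"


section \<open>Generating series\<close>

text \<open>Exponentials of formal power series over \<^typ>\<open>sym\<close>, in one and in two variables. In each
  coefficient only finitely many summands are nonzero when the series has zero constant term.\<close>

definition exp_series :: "sym fps \<Rightarrow> sym fps" where
  "exp_series F = Abs_fps (\<lambda>a. Sum_any (\<lambda>j. scale (1 / fact j) (fps_nth (F ^ j) a)))"

definition exp_series2 :: "sym fps fps \<Rightarrow> sym fps fps" where
  "exp_series2 F = Abs_fps (\<lambda>a. Abs_fps (\<lambda>b.
     Sum_any (\<lambda>j. scale (1 / fact j) (fps_nth (fps_nth (F ^ j) a) b))))"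

text \<open>The iterated type \<^typ>\<open>sym fps fps\<close> consists of the series in \<open>t\<close> (outer) and \<open>u\<close>
  (inner) with coefficients in \<^typ>\<open>sym\<close>.\<close>

definition var_t :: "sym fps fps" where "var_t = fps_X"

definition var_u :: "sym fps fps" where "var_u = fps_const fps_X"

definition const2 :: "sym \<Rightarrow> sym fps fps" where "const2 F = fps_const (fps_const F)"

text \<open>The series \<open>\<Sum>n\<ge>0. \<Sum>k\<le>n. t^(n-k) u^k D n k\<close>: the coefficient of \<open>t^a u^b\<close> comes from
  the single pair \<open>n = a + b\<close>, \<open>k = b\<close>.\<close>

definition D_series :: "(nat \<Rightarrow> nat \<Rightarrow> sym) \<Rightarrow> sym fps fps" where
  "D_series D = Abs_fps (\<lambda>a. Abs_fps (\<lambda>b. D (a + b) b))"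

definition S_series_t :: "sym fps fps" where
  "S_series_t = Abs_fps (\<lambda>m. fps_const (S m))"

end

theory Submission
  imports Defs
begin

text \<open>Let \<open>X\<^sub>j\<close> be the sum of all permutations whose word increases from position \<open>j + 1\<close> on; it
  corresponds to \<open>S\<^sub>1\<^sup>j S\<^bsub>n-j\<^esub>\<close>. Moving one of the first \<open>j\<close> letters of such a word to the front
  permutes these words, while moving one of the last \<open>n - j\<close> letters produces each summand of
  \<open>X\<^bsub>j+1\<^esub>\<close> exactly once. Hence \<open>X\<^sub>j \<tau> = j X\<^sub>j + X\<^bsub>j+1\<^esub>\<close>, so \<open>X\<^sub>j\<close> is the falling factorial
  \<open>\<tau>(\<tau>-1)\<cdots>(\<tau>-j+1)\<close>, and \<open>X\<^bsub>n-1\<^esub> = X\<^sub>n\<close> turns \<open>X\<^sub>n \<tau> = n X\<^sub>n\<close> into the annihilating polynomial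
  \<open>P\<^sub>n\<close>, whose roots are simple. The generating series gives
  \<open>D\<^bsub>n,k\<^esub> = \<Sum>\<^sub>i (-1)\<^sup>i / (k! i!) S\<^sub>1\<^bsup>k+i\<^esup> S\<^bsub>n-k-i\<^esub>\<close>, which therefore corresponds to \<open>p(\<tau>)\<close> for a
  polynomial \<open>p\<close> with \<open>p(m) = \<delta>\<^bsub>m,k\<^esub>\<close> for \<open>0 \<le> m \<le> n\<close>.\<close>

section \<open>Polynomials in a linear operator\<close>

lemma poly_op_eq_sum:
  assumes "Polynomial.degree p \<le> N"
  shows "poly_op p T v = (\<Sum>i\<le>N. scale (Polynomial.coeff p i) ((T ^^ i) v))"
  unfolding poly_op_def
  by (rule sum.mono_neutral_left) (use assms in \<open>auto simp: coeff_eq_0\<close>)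

lemma poly_op_0 [simp]: "poly_op 0 T v = 0"
  by (simp add: poly_op_def)

lemma poly_op_1 [simp]: "poly_op 1 T v = v"
  by (simp add: poly_op_def)

lemma poly_op_add: "poly_op (p + q) T v = poly_op p T v + poly_op q T v"
proof -
  let ?N = "max (Polynomial.degree p) (Polynomial.degree q)"
  have "Polynomial.degree (p + q) \<le> ?N"
    by (rule degree_add_le_max)
  then show ?thesis
    by (simp add: poly_op_eq_sum[of _ ?N] free_vs.scale_left_distrib sum.distrib)
qed

lemma poly_op_smult: "poly_op (Polynomial.smult c p) T v = scale c (poly_op p T v)"
  by (simp add: poly_op_eq_sum[of _ "Polynomial.degree p"] free_vs.scale_sum_right degree_smult_le)

lemma poly_op_diff: "poly_op (p - q) T v = poly_op p T v - poly_op q T v"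
  using poly_op_add[of "p - q" q T v] by simp

lemma poly_op_sum: "poly_op (\<Sum>i\<in>A. p i) T v = (\<Sum>i\<in>A. poly_op (p i) T v)"
  by (induction A rule: infinite_finite_induct) (auto simp: poly_op_add)

text \<open>A Horner step. It allows induction over \<open>pCons\<close> in place of manipulations
  of coefficient sums.\<close>

lemma poly_op_pCons: "poly_op (pCons a p) T v = scale a v + poly_op p T (T v)"
proof -
  have "poly_op (pCons a p) T v
      = (\<Sum>i\<le>Suc (Polynomial.degree p). scale (Polynomial.coeff (pCons a p) i) ((T ^^ i) v))"
    by (rule poly_op_eq_sum) (simp add: degree_pCons_le)
  also have "\<dots> = scale a v
      + (\<Sum>i\<le>Polynomial.degree p. scale (Polynomial.coeff p i) ((T ^^ i) (T v)))"
    by (subst sum.atMost_Suc_shift) (simp add: funpow_swap1)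
  finally show ?thesis
    by (simp add: poly_op_def)
qed

text \<open>One linear factor is split off at a time: the points of \<open>R\<close> are distinct
  and a field has no zero divisors, so the remaining points are still roots of the cofactor.\<close>

lemma linear_factors_dvd:
  fixes q :: "'a :: field poly"
  assumes "finite R" "\<And>r. r \<in> R \<Longrightarrow> poly q r = 0"
  shows "(\<Prod>r\<in>R. [:- r, 1:]) dvd q"
  using assms
proof (induction R arbitrary: q rule: finite_induct)
  case (insert a R)
  then obtain q' where q': "q = [:- a, 1:] * q'"
    by (metis dvdE insertI1 poly_eq_0_iff_dvd)
  have "poly q' r = 0" if "r \<in> R" for r
    using insert.prems[of r] insert.hyps that q' by auto
  then have "(\<Prod>r\<in>R. [:- r, 1:]) dvd q'"
    by (rule insert.IH)
  then show ?case
    using insert.hyps q' by (simp add: mult_dvd_mono del: mult_pCons_left)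
qed simp

text \<open>The product of the factors at the other points, normalised by its value at
  \<open>c\<close>. Allowing \<open>c\<close> outside \<open>R\<close> makes it possible to choose
  such a polynomial for every point.\<close>

lemma lagrange_basis_poly:
  fixes c :: "'a :: field"
  assumes "finite R"
  obtains p where "poly p c = 1" "\<And>r. r \<in> R \<Longrightarrow> r \<noteq> c \<Longrightarrow> poly p r = 0"
proof
  let ?q = "\<Prod>r\<in>R - {c}. [:- r, 1:]"
  have "poly ?q c \<noteq> 0"
    using assms by (auto simp: poly_prod)
  then show "poly (Polynomial.smult (1 / poly ?q c) ?q) c = 1"
    by simp
  show "poly (Polynomial.smult (1 / poly ?q c) ?q) r = 0" if "r \<in> R" "r \<noteq> c" for r
  proof -
    have "poly ?q r = 0"
      using assms that by (auto simp: poly_prod)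
    then show ?thesis
      by simp
  qed
qed

section \<open>Polynomials in an operator that preserves a subspace\<close>

locale linear_operator =
  fixes V :: "('a \<Rightarrow>\<^sub>0 complex) set" and T :: "('a \<Rightarrow>\<^sub>0 complex) \<Rightarrow> ('a \<Rightarrow>\<^sub>0 complex)"
  assumes subspace: "free_vs.subspace V"
    and linear: "linear_op V T"
begin

lemma
  shows closed [simp]: "v \<in> V \<Longrightarrow> T v \<in> V"
    and add: "v \<in> V \<Longrightarrow> w \<in> V \<Longrightarrow> T (v + w) = T v + T w"
    and scale: "v \<in> V \<Longrightarrow> T (scale c v) = scale c (T v)"
  using linear by (auto simp: linear_op_def)

lemma poly_op_linear: "linear_op V (poly_op p T)"
proof (induction p)
  case 0
  show ?case
    using free_vs.subspace_0[OF subspace] by (simp add: linear_op_def)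
next
  case (pCons a p)
  then show ?case
    using subspace
    by (auto simp: linear_op_def poly_op_pCons add scale free_vs.subspace_add
        free_vs.subspace_scale free_vs.scale_right_distrib add_ac mult.commute)
qed

lemma poly_op_closed [simp]: "v \<in> V \<Longrightarrow> poly_op p T v \<in> V"
  using poly_op_linear by (auto simp: linear_op_def)

lemma poly_op_commute: "v \<in> V \<Longrightarrow> poly_op p T (T v) = T (poly_op p T v)"
proof (induction p arbitrary: v)
  case 0
  then show ?case
    using scale[of v 0] by simp
next
  case (pCons a p)
  then show ?case
    using subspace by (simp add: poly_op_pCons add scale free_vs.subspace_scale)
qed

lemma poly_op_mult: "v \<in> V \<Longrightarrow> poly_op (p * q) T v = poly_op p T (poly_op q T v)"
  by (induction p arbitrary: v)
    (simp_all add: mult_pCons_left poly_op_add poly_op_smult poly_op_pCons poly_op_commute)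

lemma poly_op_eigenvector:
  "v \<in> eigenspace V T c \<Longrightarrow> poly_op p T v = scale (poly p c) v"
proof (induction p arbitrary: v)
  case (pCons a p)
  then have v: "v \<in> V" "T v = scale c v"
    by (auto simp: eigenspace_def)
  have "poly_op p T (scale c v) = scale c (poly_op p T v)"
    using poly_op_linear v by (auto simp: linear_op_def)
  then show ?case
    using v pCons by (simp add: poly_op_pCons free_vs.scale_left_distrib)
qed simp

end

text \<open>Since \<open>R\<close> is a set, the annihilating product has only simple roots; this is
  the source of diagonalizability.\<close>

locale separable_operator = linear_operator +
  fixes R :: "complex set"
  assumes finite_roots: "finite R"
    and annihilates: "v \<in> V \<Longrightarrow> poly_op (\<Prod>r\<in>R. [:- r, 1:]) T v = 0"
begin

lemma poly_op_eq_0: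
  assumes "\<And>r. r \<in> R \<Longrightarrow> poly q r = 0" "v \<in> V"
  shows "poly_op q T v = 0"
proof -
  obtain s where "q = s * (\<Prod>r\<in>R. [:- r, 1:])"
    using linear_factors_dvd[OF finite_roots assms(1)] by (metis dvdE mult.commute)
  then have "poly_op q T v = poly_op s T 0"
    using assms(2) by (simp add: poly_op_mult annihilates)
  also have "\<dots> = 0"
    using poly_op_linear[of s] free_vs.subspace_0[OF subspace]
    by (metis free_vs.scale_zero_left linear_op_def)
  finally show ?thesis .
qed

text \<open>Modulo the annihilating product a polynomial is determined by its values on
  \<open>R\<close>.\<close>

lemma poly_op_cong:
  assumes "\<And>r. r \<in> R \<Longrightarrow> poly p r = poly q r" "v \<in> V"
  shows "poly_op p T v = poly_op q T v"
  using poly_op_eq_0[of "p - q" v] assms by (simp add: poly_op_diff)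

text \<open>On an eigenvector a polynomial acts as its value at the eigenvalue, which therefore has
  to be a root of the annihilating product.\<close>

lemma spectrum_subset: "spectrum V T \<subseteq> R"
proof
  fix c
  assume "c \<in> spectrum V T"
  then obtain v where v: "v \<in> eigenspace V T c" "v \<noteq> 0"
    by (auto simp: spectrum_def)
  then have "scale (poly (\<Prod>r\<in>R. [:- r, 1:]) c) v = 0"
    using annihilates[of v] poly_op_eigenvector[OF v(1)] by (simp add: eigenspace_def)
  then show "c \<in> R"
    using v(2) finite_roots by (auto simp: poly_prod free_vs.scale_eq_0_iff)
qed

text \<open>\<open>(X - c) p\<close> vanishes on \<open>R\<close>, hence \<open>T - c\<close> kills
  the image of \<open>p(T)\<close>. This produces the eigenvectors below.\<close>

lemma poly_op_in_eigenspace: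
  assumes "\<And>r. r \<in> R \<Longrightarrow> r \<noteq> c \<Longrightarrow> poly p r = 0" "v \<in> V"
  shows "poly_op p T v \<in> eigenspace V T c"
proof -
  have "poly_op ([:- c, 1:] * p) T v = 0"
    using assms by (intro poly_op_eq_0) auto
  then have "scale (- c) (poly_op p T v) + T (poly_op p T v) = 0"
    using assms(2) by (simp add: poly_op_mult poly_op_pCons del: mult_pCons_left)
  then show ?thesis
    using assms(2) by (simp add: eigenspace_def)
qed

text \<open>Lagrange interpolation writes \<open>p\<close> on \<open>R\<close> as a sum of the
  \<open>l a * p\<close>, and each summand maps into the eigenspace of its own \<open>a\<close>. The
  condition at \<open>c\<close> is vacuous for \<open>c\<close> outside \<open>R\<close>, a case
  used for \<open>eigenspaces_span\<close>.\<close>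

lemma poly_op_in_span_eigenspaces:
  assumes "v \<in> V" "c \<in> R \<Longrightarrow> poly p c = 0"
  shows "poly_op p T v \<in> free_vs.span (\<Union>d\<in>- {c}. eigenspace V T d)"
proof -
  have "\<exists>l. poly l a = 1 \<and> (\<forall>r\<in>R. r \<noteq> a \<longrightarrow> poly l r = 0)" for a
    using lagrange_basis_poly[OF finite_roots, of a] by metis
  then obtain l where l: "\<And>a. poly (l a) a = 1" "\<And>a r. r \<in> R \<Longrightarrow> r \<noteq> a \<Longrightarrow> poly (l a) r = 0"
    by metis
  have "poly_op p T v = poly_op (\<Sum>a\<in>R - {c}. l a * p) T v"
  proof (rule poly_op_cong)
    fix r
    assume r: "r \<in> R"
    \<comment> \<open>Only the summand \<open>a = r\<close> survives at \<open>r\<close>; for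
      \<open>r = c\<close> it is absent, but there \<open>p\<close> is zero.\<close>
    have "(\<Sum>a\<in>R - {c}. poly (l a) r * poly p r) = (\<Sum>a\<in>R - {c}. if a = r then poly p r else 0)"
      using l r by (intro sum.cong) auto
    then show "poly p r = poly (\<Sum>a\<in>R - {c}. l a * p) r"
      using r assms finite_roots by (auto simp: poly_sum)
  qed fact
  also have "\<dots> = (\<Sum>a\<in>R - {c}. poly_op (l a * p) T v)"
    by (rule poly_op_sum)
  also have "\<dots> \<in> free_vs.span (\<Union>d\<in>- {c}. eigenspace V T d)"
  proof (rule free_vs.span_sum, rule free_vs.span_base)
    fix a
    assume a: "a \<in> R - {c}"
    then have "poly_op (l a * p) T v \<in> eigenspace V T a"
      using assms l by (intro poly_op_in_eigenspace) auto
    then show "poly_op (l a * p) T v \<in> (\<Union>d\<in>- {c}. eigenspace V T d)"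
      using a by auto
  qed
  finally show ?thesis .
qed

lemma eigenspaces_span: "free_vs.span (\<Union>d. eigenspace V T d) = V"
proof
  show "free_vs.span (\<Union>d. eigenspace V T d) \<subseteq> V"
    by (rule free_vs.span_minimal) (auto simp: eigenspace_def subspace)
  \<comment> \<open>At a point outside \<open>R\<close> nothing is required of the polynomial, so
    the constant 1, which acts as the identity, becomes admissible.\<close>
  obtain c where c: "c \<notin> R"
    using finite_roots ex_new_if_finite infinite_UNIV_char_0 by blast
  have "v \<in> free_vs.span (\<Union>d. eigenspace V T d)" if v: "v \<in> V" for v
  proof -
    have "poly_op 1 T v \<in> free_vs.span (\<Union>d\<in>- {c}. eigenspace V T d)"
      using v c by (intro poly_op_in_span_eigenspaces) auto
    also have "\<dots> \<subseteq> free_vs.span (\<Union>d. eigenspace V T d)"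
      by (rule free_vs.span_mono) auto
    finally show ?thesis
      by simp
  qed
  then show "V \<subseteq> free_vs.span (\<Union>d. eigenspace V T d)"
    by auto
qed

lemma diagonalizable: "diagonalizable V T"
proof -
  obtain B where B: "B \<subseteq> (\<Union>d. eigenspace V T d)" "free_vs.independent B"
    "(\<Union>d. eigenspace V T d) \<subseteq> free_vs.span B"
    using free_vs.maximal_independent_subset[of "\<Union>d. eigenspace V T d"] by blast
  have "free_vs.span B = V"
  proof
    show "free_vs.span B \<subseteq> V"
      using free_vs.span_mono[OF B(1)] eigenspaces_span by simp
    show "V \<subseteq> free_vs.span B"
      using free_vs.span_minimal[OF B(3) free_vs.subspace_span] eigenspaces_span by simp
  qed
  moreover have "B \<subseteq> V"
    using B(1) by (auto simp: eigenspace_def)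
  moreover have "\<forall>b\<in>B. \<exists>c. b \<in> eigenspace V T c"
    using B(1) by auto
  ultimately show ?thesis
    using B(2) by (auto simp: diagonalizable_def)
qed

text \<open>An annihilating polynomial vanishes at every eigenvalue, hence contains all linear
  factors once every point of \<open>R\<close> is an eigenvalue.\<close>

lemma minimal_polynomial:
  assumes "R \<subseteq> spectrum V T"
  shows "minimal_polynomial V T (\<Prod>r\<in>R. [:- r, 1:])"
  unfolding minimal_polynomial_def
proof (intro conjI ballI allI impI)
  show "Polynomial.lead_coeff (\<Prod>r\<in>R. [:- r, 1:]) = 1"
    by (simp add: lead_coeff_prod)
  fix q
  assume q: "\<forall>v\<in>V. poly_op q T v = 0"
  show "(\<Prod>r\<in>R. [:- r, 1:]) dvd q"
  proof (rule linear_factors_dvd[OF finite_roots])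
    fix r
    assume "r \<in> R"
    then obtain v where v: "v \<in> eigenspace V T r" "v \<noteq> 0"
      using assms by (auto simp: spectrum_def)
    then have "poly_op q T v = 0"
      using q by (simp add: eigenspace_def)
    then show "poly q r = 0"
      using v poly_op_eigenvector[of v r q] by simp
  qed
qed (rule annihilates)

text \<open>\<open>p\<close> is the indicator of \<open>c\<close> on \<open>R\<close>, so
  \<open>p(T)\<close> is the identity on one eigenspace and zero on the others. For \<open>c\<close>
  outside \<open>R\<close> it is zero on all of \<open>V\<close>.\<close>

lemma spectral_projector:
  assumes P: "\<And>v. v \<in> V \<Longrightarrow> P v = poly_op p T v"
    and p: "\<And>r. r \<in> R \<Longrightarrow> poly p r = (if r = c then 1 else 0)"
  shows "spectral_projector V T c P"
  unfolding spectral_projector_def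
proof (intro conjI ballI)
  \<comment> \<open>The zero vector lies in every eigenspace, also for \<open>d\<close> outside
    \<open>R\<close>, where the value of \<open>p\<close> is unknown; hence the separate
    case.\<close>
  have P_eigenvector: "P v = scale (if d = c then 1 else 0) v" if "v \<in> eigenspace V T d" for v d
  proof (cases "v = 0")
    case True
    then show ?thesis
      using poly_op_eigenvector[OF that, of p] P[of v] that by (simp add: eigenspace_def)
  next
    case False
    then have "d \<in> R"
      using that spectrum_subset by (auto simp: spectrum_def)
    then show ?thesis
      using poly_op_eigenvector[OF that, of p] P[of v] p that by (simp add: eigenspace_def)
  qed
  have P_eigenspace: "P v \<in> eigenspace V T c" if "v \<in> V" for v
    using that p by (simp add: P poly_op_in_eigenspace)
  have eigenspace_V: "eigenspace V T d \<subseteq> V" for d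
    by (auto simp: eigenspace_def)
  show linear_P: "linear_op V P"
    using poly_op_linear[of p] subspace
    by (simp add: linear_op_def P free_vs.subspace_add free_vs.subspace_scale)
  show "P (P v) = P v" if "v \<in> V" for v
    using P_eigenvector[OF P_eigenspace[OF that]] by simp
  show "P ` V = eigenspace V T c"
    using P_eigenspace P_eigenvector[of _ c] eigenspace_V[of c]
    by (auto simp: image_iff) (metis subsetD)
  show "{v \<in> V. P v = 0} = free_vs.span (\<Union>d\<in>- {c}. eigenspace V T d)"
  proof
    \<comment> \<open>\<open>1 - p\<close> vanishes at \<open>c\<close> if \<open>c\<close> is in
      \<open>R\<close>, and it acts as the identity on the kernel of \<open>P\<close>.\<close>
    have "v \<in> free_vs.span (\<Union>d\<in>- {c}. eigenspace V T d)" if "v \<in> V" "P v = 0" for v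
      using poly_op_in_span_eigenspaces[of v c "1 - p"] that p[of c] by (simp add: P poly_op_diff)
    then show "{v \<in> V. P v = 0} \<subseteq> free_vs.span (\<Union>d\<in>- {c}. eigenspace V T d)"
      by auto
    show "free_vs.span (\<Union>d\<in>- {c}. eigenspace V T d) \<subseteq> {v \<in> V. P v = 0}"
    proof (rule free_vs.span_minimal)
      show "free_vs.subspace {v \<in> V. P v = 0}"
      proof (rule free_vs.subspaceI)
        show "0 \<in> {v \<in> V. P v = 0}"
          using P_eigenvector[of 0 0] free_vs.subspace_0[OF subspace] scale[of 0 0]
          by (simp add: eigenspace_def)
      qed (use linear_P subspace in
          \<open>auto simp: linear_op_def free_vs.subspace_add free_vs.subspace_scale\<close>)
    qed (use P_eigenvector eigenspace_V in fastforce)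
  qed
qed

end

section \<open>Convolution\<close>

lemma poly_mapping_eq_sum_single:
  "f = (\<Sum>x\<in>Poly_Mapping.keys f. Poly_Mapping.single x (Poly_Mapping.lookup f x))"
  by (rule poly_mapping_eqI) (simp add: lookup_sum lookup_single when_def in_keys_iff)

lemma scale_single [simp]: "scale c (Poly_Mapping.single x a) = Poly_Mapping.single x (c * a)"
  by (rule poly_mapping_eqI) (simp add: lookup_single when_def)

lemma subspace_supported_on: "free_vs.subspace {f. Poly_Mapping.keys f \<subseteq> A}"
proof (rule free_vs.subspaceI)
  fix f g :: "'a \<Rightarrow>\<^sub>0 complex" and c
  assume f: "f \<in> {f. Poly_Mapping.keys f \<subseteq> A}"
  show "scale c f \<in> {f. Poly_Mapping.keys f \<subseteq> A}"
    using f by (simp add: subset_iff in_keys_iff)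
  assume "g \<in> {f. Poly_Mapping.keys f \<subseteq> A}"
  then show "f + g \<in> {f. Poly_Mapping.keys f \<subseteq> A}"
    using f keys_add[of f g] by blast
qed simp

lemma subspace_group_algebra: "free_vs.subspace (group_algebra G)"
  unfolding group_algebra_def by (rule subspace_supported_on)

lemma single_in_group_algebra: "x \<in> carrier G \<Longrightarrow> Poly_Mapping.single x a \<in> group_algebra G"
  by (simp add: group_algebra_def)

text \<open>Membership of the partial sums is proved together with \<open>P\<close>, because the
  \<open>add\<close> case has it as a premise.\<close>

lemma group_algebra_induct [consumes 1, case_names single add]:
  assumes "f \<in> group_algebra G"
    and "\<And>x a. x \<in> carrier G \<Longrightarrow> P (Poly_Mapping.single x a)"
    and "\<And>f g. f \<in> group_algebra G \<Longrightarrow> g \<in> group_algebra G \<Longrightarrow> P f \<Longrightarrow> P g \<Longrightarrow> P (f + g)"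
    and "P 0"
  shows "P f"
proof -
  have "(\<Sum>x\<in>A. Poly_Mapping.single x (Poly_Mapping.lookup f x)) \<in> group_algebra G
      \<and> P (\<Sum>x\<in>A. Poly_Mapping.single x (Poly_Mapping.lookup f x))" if "finite A" "A \<subseteq> carrier G" for A
    using that
  proof (induction A rule: finite_induct)
    case empty
    show ?case
      using assms(4) by (simp add: group_algebra_def)
  next
    case (insert x A)
    then show ?case
      using assms(2,3) free_vs.subspace_add[OF subspace_group_algebra] single_in_group_algebra
      by (metis (no_types, lifting) insert_subset sum.insert)
  qed
  from this[of "Poly_Mapping.keys f"] show ?thesis
    using assms(1) poly_mapping_eq_sum_single[of f] by (simp add: group_algebra_def)
qed

text \<open>Enlarging the index sets only adds zero terms. Common index sets let the bilinearity
  proofs distribute termwise.\<close>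

lemma conv_eq_sum:
  assumes "finite A" "Poly_Mapping.keys f \<subseteq> A" "finite B" "Poly_Mapping.keys g \<subseteq> B"
  shows "conv G f g = (\<Sum>x\<in>A. \<Sum>y\<in>B.
    Poly_Mapping.single (x \<otimes>\<^bsub>G\<^esub> y) (Poly_Mapping.lookup f x * Poly_Mapping.lookup g y))"
proof -
  have "conv G f g = (\<Sum>x\<in>Poly_Mapping.keys f. \<Sum>y\<in>B.
      Poly_Mapping.single (x \<otimes>\<^bsub>G\<^esub> y) (Poly_Mapping.lookup f x * Poly_Mapping.lookup g y))"
    unfolding conv_def
    by (intro sum.cong sum.mono_neutral_left) (use assms in \<open>auto simp: in_keys_iff\<close>)
  also have "\<dots> = (\<Sum>x\<in>A. \<Sum>y\<in>B.
      Poly_Mapping.single (x \<otimes>\<^bsub>G\<^esub> y) (Poly_Mapping.lookup f x * Poly_Mapping.lookup g y))"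
    by (intro sum.mono_neutral_left) (use assms in \<open>auto simp: in_keys_iff\<close>)
  finally show ?thesis .
qed

lemma conv_add_left: "conv G (f + f') g = conv G f g + conv G f' g"
proof -
  let ?A = "Poly_Mapping.keys f \<union> Poly_Mapping.keys f'"
  have "Poly_Mapping.keys (f + f') \<subseteq> ?A"
    by (rule keys_add)
  then show ?thesis
    by (simp add: conv_eq_sum[of ?A _ "Poly_Mapping.keys g"] lookup_add distrib_right single_add
        sum.distrib)
qed

lemma conv_add_right: "conv G f (g + g') = conv G f g + conv G f g'"
proof -
  let ?B = "Poly_Mapping.keys g \<union> Poly_Mapping.keys g'"
  have "Poly_Mapping.keys (g + g') \<subseteq> ?B"
    by (rule keys_add)
  then show ?thesis
    by (simp add: conv_eq_sum[of "Poly_Mapping.keys f" _ ?B] lookup_add distrib_left single_add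
        sum.distrib)
qed

lemma conv_scale_left: "conv G (scale c f) g = scale c (conv G f g)"
  by (simp add: conv_eq_sum[of "Poly_Mapping.keys f" _ "Poly_Mapping.keys g"] subset_iff
      in_keys_iff free_vs.scale_sum_right mult.assoc)

lemma conv_scale_right: "conv G f (scale c g) = scale c (conv G f g)"
  by (simp add: conv_eq_sum[of "Poly_Mapping.keys f" _ "Poly_Mapping.keys g"] subset_iff
      in_keys_iff free_vs.scale_sum_right mult_ac)

lemma conv_zero [simp]: "conv G 0 g = 0" "conv G f 0 = 0"
  by (simp_all add: conv_def)

lemma conv_sum_left: "conv G (\<Sum>i\<in>I. f i) g = (\<Sum>i\<in>I. conv G (f i) g)"
  by (induction I rule: infinite_finite_induct) (simp_all add: conv_add_left)

lemma conv_sum_right: "conv G f (\<Sum>i\<in>I. g i) = (\<Sum>i\<in>I. conv G f (g i))"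
  by (induction I rule: infinite_finite_induct) (simp_all add: conv_add_right)

lemma conv_single:
  "conv G (Poly_Mapping.single x a) (Poly_Mapping.single y b) = Poly_Mapping.single (x \<otimes>\<^bsub>G\<^esub> y) (a * b)"
  by (subst conv_eq_sum[of "{x}" _ "{y}"]) auto

context monoid
begin

lemma conv_closed:
  assumes "f \<in> group_algebra G" "g \<in> group_algebra G"
  shows "conv G f g \<in> group_algebra G"
  unfolding conv_def
  using assms subspace_group_algebra
  by (intro free_vs.subspace_sum single_in_group_algebra) (auto simp: group_algebra_def)

lemma conv_assoc:
  assumes "f \<in> group_algebra G" "g \<in> group_algebra G" "h \<in> group_algebra G"
  shows "conv G (conv G f g) h = conv G f (conv G g h)"
  using assms(1)
proof (induction rule: group_algebra_induct)
  case (single x a)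
  note x = this
  show ?case
    using assms(2)
  proof (induction rule: group_algebra_induct)
    case (single y b)
    note y = this
    show ?case
      using assms(3)
      by (induction rule: group_algebra_induct)
        (simp_all add: x y conv_single m_assoc conv_add_right mult.assoc)
  qed (simp_all add: conv_add_left conv_add_right)
qed (simp_all add: conv_add_left)

lemma conv_one_right: "f \<in> group_algebra G \<Longrightarrow> conv G f (Poly_Mapping.single \<one> 1) = f"
  by (induction rule: group_algebra_induct) (simp_all add: conv_single conv_add_left)

lemma conv_one_left: "f \<in> group_algebra G \<Longrightarrow> conv G (Poly_Mapping.single \<one> 1) f = f"
  by (induction rule: group_algebra_induct) (simp_all add: conv_single conv_add_right)

lemma linear_op_conv_right: "g \<in> group_algebra G \<Longrightarrow> linear_op (group_algebra G) (\<lambda>f. conv G f g)"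
  by (simp add: linear_op_def conv_closed conv_add_left conv_scale_left)

end

section \<open>Moving a letter to the front\<close>

text \<open>Right composition acts on positions: \<open>p \<circ> to_front k\<close> is the word of
  \<open>p\<close> with its letter at position \<open>k\<close> moved to the front, and
  \<open>from_front k\<close> puts the first letter back there. Neither formula depends on
  \<open>n\<close>.\<close>

definition to_front :: "nat \<Rightarrow> nat \<Rightarrow> nat" where
  "to_front k i = (if i = 1 then k else if 2 \<le> i \<and> i \<le> k then i - 1 else i)"

definition from_front :: "nat \<Rightarrow> nat \<Rightarrow> nat" where
  "from_front k i = (if i = k then 1 else if 1 \<le> i \<and> i < k then i + 1 else i)"

lemma perm_of_word_to_front:
  assumes "k \<in> {1..n}"
  shows "perm_of_word (k # remove1 k [1..<Suc n]) = to_front k"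
proof
  fix i
  have "[1..<Suc n] = [1..<k] @ k # [Suc k..<Suc n]"
    using assms upt_add_eq_append[of 1 k "Suc n - k"] upt_conv_Cons[of k "Suc n"] by simp
  then have "remove1 k [1..<Suc n] = [1..<k] @ [Suc k..<Suc n]"
    by (simp add: remove1_append)
  then show "perm_of_word (k # remove1 k [1..<Suc n]) i = to_front k i"
    using assms by (auto simp: perm_of_word_def to_front_def nth_Cons' nth_append)
qed

lemma to_front_from_front [simp]: "k \<ge> 1 \<Longrightarrow> to_front k (from_front k i) = i"
  by (auto simp: to_front_def from_front_def)

lemma from_front_to_front [simp]: "k \<ge> 1 \<Longrightarrow> from_front k (to_front k i) = i"
  by (auto simp: to_front_def from_front_def)

lemma to_front_permutes: "k \<in> {1..n} \<Longrightarrow> to_front k permutes {1..n}"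
  by (rule bij_imp_permutes, rule bij_betw_byWitness[of _ "from_front k"])
    (auto simp: to_front_def from_front_def)

lemma from_front_permutes: "k \<in> {1..n} \<Longrightarrow> from_front k permutes {1..n}"
  by (rule bij_imp_permutes, rule bij_betw_byWitness[of _ "to_front k"])
    (auto simp: to_front_def from_front_def)

lemma tau_eq: "tau n = (\<Sum>k\<in>{1..n}. Poly_Mapping.single (to_front k) 1)"
  unfolding tau_def by (intro sum.cong refl) (simp only: perm_of_word_to_front)

lemma tau_in_CS: "tau n \<in> CS n"
  unfolding tau_eq
  by (intro free_vs.subspace_sum subspace_group_algebra single_in_group_algebra)
    (simp only: sym_group_carrier to_front_permutes)

section \<open>Permutations with increasing tail\<close>

definition tail_increasing :: "nat \<Rightarrow> nat \<Rightarrow> (nat \<Rightarrow> nat) set" where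
  "tail_increasing n j = {p. p permutes {1..n} \<and> strict_mono_on {j<..n} p}"

text \<open>This is \<open>X\<^sub>j\<close> of the introduction.\<close>

definition tail_sum :: "nat \<Rightarrow> nat \<Rightarrow> ((nat \<Rightarrow> nat) \<Rightarrow>\<^sub>0 complex)" where
  "tail_sum n j = (\<Sum>p\<in>tail_increasing n j. Poly_Mapping.single p 1)"

lemma finite_tail_increasing [simp]: "finite (tail_increasing n j)"
  by (rule finite_subset[OF _ finite_permutations[of "{1..n}"]]) (auto simp: tail_increasing_def)

lemma tail_increasingD:
  assumes "p \<in> tail_increasing n j" "j < i" "i \<le> n" "j < i'" "i' \<le> n"
  shows "p i < p i' \<longleftrightarrow> i < i'"
  using assms strict_mono_on_less[of "{j<..n}" p i i'] by (simp add: tail_increasing_def)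

text \<open>Injectivity turns the absence of a descent into a strict ascent, and ascents chain along
  the tail. The descent form is the one \<open>to_descent_algebra\<close> uses.\<close>

lemma tail_increasing_iff:
  "p \<in> tail_increasing n j \<longleftrightarrow> p permutes {1..n} \<and> descent_set n p \<subseteq> {1..j}"
proof (cases "p permutes {1..n}")
  case True
  have "strict_mono_on {j<..n} p" if d: "descent_set n p \<subseteq> {1..j}"
  proof (rule strict_mono_onI)
    fix r s
    assume rs: "r \<in> {j<..n}" "s \<in> {j<..n}" "r < s"
    have step: "p i < p (Suc i)" if "j < i" "i < n" for i
    proof -
      have "i \<notin> descent_set n p"
        using d that by auto
      moreover have "p i \<noteq> p (Suc i)"
        using permutes_inj[OF True] by (simp add: inj_eq)
      ultimately show ?thesis
        using that by (simp add: descent_set_def)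
    qed
    show "p r < p s"
      using \<open>r < s\<close> rs
    proof (induction rule: less_Suc_induct)
      case (1 i)
      then show ?case
        using step by simp
    qed auto
  qed
  moreover have "descent_set n p \<subseteq> {1..j}" if "strict_mono_on {j<..n} p"
  proof
    fix i
    assume i: "i \<in> descent_set n p"
    have "\<not> j < i"
      using strict_mono_onD[OF that, of i "i + 1"] i by (auto simp: descent_set_def)
    then show "i \<in> {1..j}"
      using i by (auto simp: descent_set_def)
  qed
  ultimately show ?thesis
    using True by (auto simp: tail_increasing_def)
qed (simp add: tail_increasing_def)

text \<open>An increasing permutation satisfies \<open>i \<le> p i\<close> by induction, which
  forces the identity. Thus \<open>X\<^sub>0\<close> is the unit.\<close>

lemma tail_increasing_0: "tail_increasing n 0 = {id}"
proof -
  have "p = id" if "p \<in> tail_increasing n 0" for p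
  proof -
    have p: "p permutes {1..n}" "strict_mono_on {0<..n} p"
      using that by (auto simp: tail_increasing_def)
    have "i \<le> p i" if "i \<in> {1..n}" for i
      using that
    proof (induction i)
      case (Suc i)
      show ?case
      proof (cases "i = 0")
        case True
        then show ?thesis
          using permutes_in_image[OF p(1), of 1] Suc.prems by simp
      next
        case False
        then show ?thesis
          using Suc strict_mono_onD[OF p(2), of i "Suc i"] by simp
      qed
    qed simp
    then show ?thesis
      using permutes_natset_ge[OF p(1)] by blast
  qed
  then show ?thesis
    by (auto simp: tail_increasing_def strict_mono_on_def permutes_id)
qed

text \<open>Tails of length one and zero are both trivially increasing. This coincidence is what
  removes \<open>n - 1\<close> from the spectrum.\<close>

lemma tail_increasing_pred: "n \<ge> 1 \<Longrightarrow> tail_increasing n (n - 1) = tail_increasing n n"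
  by (auto simp: tail_increasing_def strict_mono_on_def)

lemma tail_increasing_comp_fixing:
  assumes "p \<in> tail_increasing n j" "q permutes {1..n}" "\<And>i. j < i \<Longrightarrow> q i = i"
  shows "p \<circ> q \<in> tail_increasing n j"
  using assms by (auto simp: tail_increasing_def permutes_compose strict_mono_on_def)

text \<open>Only positions up to \<open>k \<le> j\<close> are moved, so the tail stays in
  place.\<close>

lemma bij_betw_comp_to_front_fixed:
  assumes "1 \<le> k" "k \<le> j" "j \<le> n"
  shows "bij_betw (\<lambda>p. p \<circ> to_front k) (tail_increasing n j) (tail_increasing n j)"
proof (rule bij_betw_byWitness[of _ "\<lambda>p. p \<circ> from_front k"])
  show "(\<lambda>p. p \<circ> to_front k) ` tail_increasing n j \<subseteq> tail_increasing n j"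
    using assms
    by (auto intro!: tail_increasing_comp_fixing to_front_permutes) (auto simp: to_front_def)
  show "(\<lambda>p. p \<circ> from_front k) ` tail_increasing n j \<subseteq> tail_increasing n j"
    using assms
    by (auto intro!: tail_increasing_comp_fixing from_front_permutes) (auto simp: from_front_def)
qed (use assms in \<open>auto simp: fun_eq_iff\<close>)

text \<open>Taking a letter out of the tail leaves the others in order, in a tail that starts one
  position later. Conversely the first letter has exactly one sorted place in the tail.\<close>

lemma bij_betw_comp_to_front:
  assumes "j < n"
  shows "bij_betw (\<lambda>(k, p). p \<circ> to_front k) ({j<..n} \<times> tail_increasing n j)
    (tail_increasing n (Suc j))"
proof -
  \<comment> \<open>\<open>slot q\<close> is the position from which the first letter of \<open>q\<close> was taken: the place where
    reinserting it keeps the tail increasing.\<close>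
  define slot where "slot q = Max (insert (Suc j) {i \<in> {j + 2..n}. q i < q 1})" for q :: "nat \<Rightarrow> nat"
  have slot: "slot (p \<circ> to_front k) = k" if k: "j < k" "k \<le> n" and p: "p \<in> tail_increasing n j" for k p
  proof -
    \<comment> \<open>The moved letter is \<open>p k\<close>, and positions \<open>j + 2\<close> to
      \<open>k\<close> now hold the smaller tail letters. For \<open>k = j + 1\<close> there are
      none, and the inserted \<open>Suc j\<close> gives the right maximum.\<close>
    have "p (to_front k i) < p (to_front k 1) \<longleftrightarrow> i \<le> k" if "i \<in> {j + 2..n}" for i
      using that k tail_increasingD[OF p, of "to_front k i" k] by (auto simp: to_front_def)
    then have "insert (Suc j) {i \<in> {j + 2..n}. (p \<circ> to_front k) i < (p \<circ> to_front k) 1} = {Suc j..k}"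
      using k by auto
    moreover have "Max {Suc j..k} = k"
      using k by (intro Max_eqI) auto
    ultimately show ?thesis
      by (simp add: slot_def del: o_apply)
  qed
  have comp: "p \<circ> to_front k \<in> tail_increasing n (Suc j)"
    if k: "j < k" "k \<le> n" and p: "p \<in> tail_increasing n j" for k p
  proof -
    have "strict_mono_on {Suc j<..n} (p \<circ> to_front k)"
      using k tail_increasingD[OF p] by (intro strict_mono_onI) (auto simp: to_front_def)
    then show ?thesis
      using k p by (auto simp: tail_increasing_def simp del: One_nat_def
          intro!: permutes_compose to_front_permutes)
  qed
  have slot_range: "j < slot q" "slot q \<le> n" for q
    using assms Max_in[of "insert (Suc j) {i \<in> {j + 2..n}. q i < q 1}"] by (auto simp: slot_def)
  have comp': "q \<circ> from_front (slot q) \<in> tail_increasing n j"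
    if q: "q \<in> tail_increasing n (Suc j)" for q
  proof -
    let ?k = "slot q"
    have fin: "finite (insert (Suc j) {i \<in> {j + 2..n}. q i < q 1})"
      by simp
    \<comment> \<open>The facts \<open>below\<close> and \<open>above\<close> say that
      \<open>q 1\<close> fits in order at position \<open>slot q\<close>: the first follows from
      monotonicity of the tail, the second from maximality of the slot and injectivity.\<close>
    have below: "q i < q 1" if "Suc j < i" "i \<le> ?k" for i
    proof -
      have "?k \<in> insert (Suc j) {i \<in> {j + 2..n}. q i < q 1}"
        unfolding slot_def by (rule Max_in) auto
      then have "q ?k < q 1" "?k \<le> n"
        using that by auto
      moreover have "q i \<le> q ?k"
        using tail_increasingD[OF q, of i ?k] that \<open>?k \<le> n\<close> by (cases "i = ?k") auto
      ultimately show ?thesis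
        by simp
    qed
    have above: "q 1 < q i" if "?k < i" "i \<le> n" for i
    proof -
      have "i \<notin> insert (Suc j) {i \<in> {j + 2..n}. q i < q 1}"
        using Max_ge[OF fin, of i] that(1) leD unfolding slot_def by blast
      then have "q 1 \<le> q i"
        using that slot_range(1)[of q] by auto
      moreover have "q 1 \<noteq> q i"
        using q that slot_range(1)[of q] permutes_inj[of q "{1..n}"]
        by (auto simp: tail_increasing_def inj_eq)
      ultimately show ?thesis
        by simp
    qed
    have "strict_mono_on {j<..n} (q \<circ> from_front ?k)"
      using slot_range[of q] tail_increasingD[OF q] below above
      by (intro strict_mono_onI) (auto simp: from_front_def)
    then show ?thesis
      using slot_range[of q] q
      by (auto simp: tail_increasing_def simp del: One_nat_def
          intro!: permutes_compose from_front_permutes)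
  qed
  show ?thesis
  proof (rule bij_betw_byWitness[of _ "\<lambda>q. (slot q, q \<circ> from_front (slot q))"])
    show "\<forall>kp\<in>{j<..n} \<times> tail_increasing n j. (\<lambda>q. (slot q, q \<circ> from_front (slot q)))
        ((\<lambda>(k, p). p \<circ> to_front k) kp) = kp"
      using slot by (auto simp: fun_eq_iff simp del: o_apply) auto
    show "\<forall>q\<in>tail_increasing n (Suc j). (\<lambda>(k, p). p \<circ> to_front k) (slot q, q \<circ> from_front (slot q)) = q"
    proof -
      have "1 \<le> slot q" for q
        using slot_range(1)[of q] by simp
      then show ?thesis
        by (simp add: fun_eq_iff)
    qed
  qed (use comp comp' slot_range in auto)
qed

lemma tail_sum_in_CS: "tail_sum n j \<in> CS n"
  unfolding tail_sum_def
  by (intro free_vs.subspace_sum subspace_group_algebra single_in_group_algebra)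
    (simp add: sym_group_carrier tail_increasing_def)

lemma conv_tail_sum_tau:
  assumes "j \<le> n"
  shows "conv (sym_group n) (tail_sum n j) (tau n)
    = scale (of_nat j) (tail_sum n j) + (if j < n then tail_sum n (Suc j) else 0)"
proof -
  let ?f = "\<lambda>k. \<Sum>p\<in>tail_increasing n j. Poly_Mapping.single (p \<circ> to_front k) (1 :: complex)"
  have "conv (sym_group n) (tail_sum n j) (tau n)
      = (\<Sum>k\<in>{1..n}. conv (sym_group n) (tail_sum n j) (Poly_Mapping.single (to_front k) 1))"
    by (simp only: tau_eq conv_sum_right)
  also have "\<dots> = (\<Sum>k\<in>{1..n}. ?f k)"
    by (simp only: tail_sum_def conv_sum_left conv_single sym_group_mult mult_1)
  also have "{1..n} = {1..j} \<union> {j<..n}"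
    using assms by auto
  also have "(\<Sum>k\<in>{1..j} \<union> {j<..n}. ?f k) = (\<Sum>k\<in>{1..j}. ?f k) + (\<Sum>k\<in>{j<..n}. ?f k)"
    by (rule sum.union_disjoint) auto
  also have "(\<Sum>k\<in>{1..j}. ?f k) = (\<Sum>k\<in>{1..j}. tail_sum n j)"
    unfolding tail_sum_def
    by (intro sum.cong refl sum.reindex_bij_betw[OF bij_betw_comp_to_front_fixed]) (use assms in auto)
  also have "\<dots> = scale (of_nat j) (tail_sum n j)"
    by (simp add: free_vs.sum_constant_scale)
  also have "(\<Sum>k\<in>{j<..n}. ?f k) = (if j < n then tail_sum n (Suc j) else 0)"
  proof (cases "j < n")
    case True
    have "(\<Sum>k\<in>{j<..n}. ?f k) = (\<Sum>kp\<in>{j<..n} \<times> tail_increasing n j.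
        Poly_Mapping.single ((\<lambda>(k, p). p \<circ> to_front k) kp) 1)"
      by (simp add: sum.cartesian_product case_prod_unfold)
    also have "\<dots> = tail_sum n (Suc j)"
      unfolding tail_sum_def by (rule sum.reindex_bij_betw[OF bij_betw_comp_to_front[OF True]])
    finally show ?thesis
      using True by simp
  qed (use assms in auto)
  finally show ?thesis .
qed

section \<open>The spectrum of the operator\<close>

definition falling_factorial :: "nat \<Rightarrow> complex poly" where
  "falling_factorial j = (\<Prod>i<j. [:- of_nat i, 1:])"

lemma poly_falling_factorial:
  "poly (falling_factorial j) (of_nat m) = fact j * of_nat (m choose j)"
proof -
  have "poly (falling_factorial j) (of_nat m) = (\<Prod>i<j. of_nat m - of_nat i)"
    by (simp add: falling_factorial_def poly_prod)
  also have "\<dots> = fact j * (of_nat m gchoose j)"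
    by (simp add: gbinomial_prod_rev atLeast0LessThan)
  finally show ?thesis
    by (simp add: binomial_gbinomial)
qed

text \<open>The coefficient of \<open>t^i u^k\<close> in the exponential series of
  \<open>u - t\<close>.\<close>

definition projector_coeff :: "nat \<Rightarrow> nat \<Rightarrow> complex" where
  "projector_coeff k i = (- 1) ^ i / (fact k * fact i)"

definition projector_poly :: "nat \<Rightarrow> nat \<Rightarrow> complex poly" where
  "projector_poly n k = (\<Sum>i\<le>n - k. Polynomial.smult (projector_coeff k i) (falling_factorial (k + i)))"

text \<open>The sum becomes \<open>m choose k\<close> times an alternating sum over the row
  \<open>m - k\<close> of Pascal's triangle, which vanishes unless \<open>m = k\<close>. As
  \<open>m = n - 1\<close> is no eigenvalue, the case \<open>k = n - 1\<close> will yield the zero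
  projector.\<close>

lemma poly_projector_poly:
  assumes "k \<le> n" "m \<le> n"
  shows "poly (projector_poly n k) (of_nat m) = (if m = k then 1 else 0)"
proof -
  have term_eq: "projector_coeff k i * (fact (k + i) * of_nat (m choose (k + i)))
      = of_nat (m choose k) * ((- 1) ^ i * of_nat ((m - k) choose i))" for i
  proof (cases "k + i \<le> m")
    case True
    have "of_nat (m choose (k + i)) * of_nat ((k + i) choose k)
        = (of_nat (m choose k) * of_nat ((m - k) choose i) :: complex)"
      using choose_mult[of k "k + i" m] True by (simp flip: of_nat_mult)
    moreover have "fact (k + i) = fact k * fact i * (of_nat ((k + i) choose k) :: complex)"
      by (simp add: binomial_fact)
    ultimately show ?thesis
      by (simp add: projector_coeff_def field_simps)
  next
    \<comment> \<open>For \<open>k > m\<close> the truncated \<open>m - k\<close> is 0 and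
      \<open>0 choose 0\<close> is 1; the right side is zero because of
      \<open>m choose k\<close>.\<close>
    case False
    then show ?thesis
      by (cases "k \<le> m") (auto simp: binomial_eq_0)
  qed
  have "poly (projector_poly n k) (of_nat m)
      = of_nat (m choose k) * (\<Sum>i\<le>n - k. (- 1) ^ i * of_nat ((m - k) choose i))"
    by (simp add: projector_poly_def poly_sum poly_falling_factorial term_eq sum_distrib_left)
  also have "(\<Sum>i\<le>n - k. (- 1) ^ i * of_nat ((m - k) choose i))
      = (\<Sum>i\<le>m - k. (- 1) ^ i * of_nat ((m - k) choose i) :: complex)"
    by (rule sum.mono_neutral_right) (use assms in \<open>auto simp: binomial_eq_0\<close>)
  also have "of_nat (m choose k) * \<dots> = (if m = k then 1 else 0)"
    using choose_alternating_sum[of "m - k", where 'a = complex]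
    by (cases m k rule: linorder_cases) (auto simp: binomial_eq_0)
  finally show ?thesis .
qed

lemmas conv_sym_group_assoc = monoid.conv_assoc[OF group.is_monoid[OF sym_group_is_group]]

lemma linear_operator_t_op: "linear_operator (CS n) (t_op n)"
  by unfold_locales
    (use subspace_group_algebra monoid.linear_op_conv_right[OF group.is_monoid[OF sym_group_is_group] tau_in_CS]
      in \<open>simp_all add: t_op_def[abs_def]\<close>)

lemma tail_sum_0: "tail_sum n 0 = Poly_Mapping.single \<one>\<^bsub>sym_group n\<^esub> 1"
  by (simp add: tail_sum_def tail_increasing_0 sym_group_one)

lemma tail_sum_1: "n \<ge> 1 \<Longrightarrow> tail_sum n 1 = tau n"
  using conv_tail_sum_tau[of 0 n]
    monoid.conv_one_left[OF group.is_monoid[OF sym_group_is_group] tau_in_CS[of n]]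
  by (simp add: tail_sum_0)

lemma t_op_conv_tail_sum:
  assumes "f \<in> CS n" "j \<le> n"
  shows "t_op n (conv (sym_group n) f (tail_sum n j))
    = scale (of_nat j) (conv (sym_group n) f (tail_sum n j))
      + (if j < n then conv (sym_group n) f (tail_sum n (Suc j)) else 0)"
  using assms
  by (simp add: t_op_def conv_sym_group_assoc tail_sum_in_CS tau_in_CS conv_tail_sum_tau
      conv_add_right conv_scale_right)

lemma conv_tail_sum:
  assumes "f \<in> CS n" "j \<le> n"
  shows "conv (sym_group n) f (tail_sum n j) = poly_op (falling_factorial j) (t_op n) f"
  using assms(2)
proof (induction j)
  case 0
  show ?case
    using monoid.conv_one_right[OF group.is_monoid[OF sym_group_is_group] assms(1)]
    by (simp add: tail_sum_0 falling_factorial_def)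
next
  case (Suc j)
  interpret linear_operator "CS n" "t_op n"
    by (rule linear_operator_t_op)
  have "falling_factorial (Suc j) = [:- of_nat j, 1:] * falling_factorial j"
    by (simp add: falling_factorial_def mult.commute del: mult_pCons_left mult_pCons_right)
  then show ?case
    using t_op_conv_tail_sum[OF assms(1), of j] Suc assms(1)
    by (simp add: poly_op_mult poly_op_pCons del: mult_pCons_left)
qed

text \<open>The form \<open>k + 2 \<le> n\<close> avoids truncated subtraction: for
  \<open>n = 1\<close> the condition \<open>k \<le> n - 2\<close> would wrongly admit 0.\<close>

definition eigenvalues :: "nat \<Rightarrow> complex set" where
  "eigenvalues n = of_nat ` ({k. k + 2 \<le> n} \<union> {n})"

lemma finite_eigenvalues: "finite (eigenvalues n)"
proof -
  have "{k. k + 2 \<le> n} \<subseteq> {..n}"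
    by auto
  then show ?thesis
    unfolding eigenvalues_def by (auto intro: finite_subset)
qed

lemma prod_eigenvalues:
  "(\<Prod>r\<in>eigenvalues n. [:- r, 1:]) = [:- of_nat n, 1:] * (\<Prod>k | k + 2 \<le> n. [:- of_nat k, 1:])"
proof -
  have "inj_on (of_nat :: nat \<Rightarrow> complex) ({k. k + 2 \<le> n} \<union> {n})"
    by (simp add: inj_on_def)
  then have "(\<Prod>r\<in>eigenvalues n. [:- r, 1:]) = (\<Prod>k\<in>insert n {k. k + 2 \<le> n}. [:- of_nat k, 1:])"
    unfolding eigenvalues_def by (simp only: prod.reindex o_def Un_insert_right Un_empty_right)
  also have "finite {k. k + 2 \<le> n}"
    by (rule finite_subset[of _ "{..n}"]) auto
  then have "(\<Prod>k\<in>insert n {k. k + 2 \<le> n}. [:- of_nat k, 1:])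
      = [:- of_nat n, 1:] * (\<Prod>k | k + 2 \<le> n. [:- of_nat k, 1 :: complex:])"
    by (rule prod.insert) simp
  finally show ?thesis .
qed

lemma separable_operator_t_op:
  assumes "n \<ge> 1"
  shows "separable_operator (CS n) (t_op n) (eigenvalues n)"
proof -
  interpret linear_operator "CS n" "t_op n"
    by (rule linear_operator_t_op)
  have "{k. k + 2 \<le> n} = {..<n - 1}"
    by auto
  then have eq: "(\<Prod>r\<in>eigenvalues n. [:- r, 1:]) = [:- of_nat n, 1:] * falling_factorial (n - 1)"
    by (simp add: prod_eigenvalues falling_factorial_def del: mult_pCons_left)
  have "poly_op (\<Prod>r\<in>eigenvalues n. [:- r, 1:]) (t_op n) f = 0" if f: "f \<in> CS n" for f
  proof -
    \<comment> \<open>The last two tail sums coincide, since a single last letter imposes no condition.\<close>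
    have "tail_sum n (n - 1) = tail_sum n n"
      by (simp only: tail_sum_def tail_increasing_pred[OF assms])
    then have "poly_op (falling_factorial (n - 1)) (t_op n) f = conv (sym_group n) f (tail_sum n n)"
      using f by (simp flip: conv_tail_sum)
    then show ?thesis
      using t_op_conv_tail_sum[OF f, of n] f
      by (simp add: eq poly_op_mult poly_op_pCons del: mult_pCons_left)
  qed
  then show ?thesis
    by unfold_locales (auto simp: finite_eigenvalues)
qed

text \<open>\<open>projector_poly n k\<close> evaluated at \<open>tau n\<close>; it turns out to be
  the image of \<open>D n k\<close>.\<close>

definition projector_element :: "nat \<Rightarrow> nat \<Rightarrow> ((nat \<Rightarrow> nat) \<Rightarrow>\<^sub>0 complex)" where
  "projector_element n k = (\<Sum>i\<le>n - k. scale (projector_coeff k i) (tail_sum n (k + i)))"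

lemma conv_projector_element:
  assumes "f \<in> CS n" "k \<le> n"
  shows "conv (sym_group n) f (projector_element n k) = poly_op (projector_poly n k) (t_op n) f"
  unfolding projector_element_def projector_poly_def conv_sum_right conv_scale_right
    poly_op_sum poly_op_smult
  by (intro sum.cong) (use assms in \<open>simp_all add: conv_tail_sum\<close>)

lemma projector_element_in_CS: "projector_element n k \<in> CS n"
  unfolding projector_element_def
  by (intro free_vs.subspace_sum free_vs.subspace_scale subspace_group_algebra tail_sum_in_CS)

section \<open>Every listed eigenvalue occurs\<close>

lemma lookup_tail_sum:
  "Poly_Mapping.lookup (tail_sum n j) p = (if p \<in> tail_increasing n j then 1 else 0)"
  by (simp add: tail_sum_def lookup_sum lookup_single when_def)

text \<open>The transposition of the last two letters has its only descent at \<open>m\<close>. It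
  serves as a test permutation that few tail sums contain.\<close>

lemma transpose_in_tail_increasing_iff:
  assumes "m \<ge> 1"
  shows "Transposition.transpose m (Suc m) \<in> tail_increasing (Suc m) j \<longleftrightarrow> m \<le> j"
proof -
  have "descent_set (Suc m) (Transposition.transpose m (Suc m)) = {m}"
    using assms by (auto simp: descent_set_def Transposition.transpose_def split: if_splits)
  moreover have "Transposition.transpose m (Suc m) permutes {1..Suc m}"
    using assms by (intro permutes_swap_id) auto
  ultimately show ?thesis
    using assms by (auto simp: tail_increasing_iff)
qed

lemma projector_element_nonzero:
  assumes "k + 2 \<le> n \<or> k = n"
  shows "projector_element n k \<noteq> 0"
proof (cases "k = n")
  case True
  have "id \<in> tail_increasing n n"
    by (simp add: tail_increasing_def strict_mono_on_def permutes_id)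
  then have "Poly_Mapping.lookup (projector_element n k) id \<noteq> 0"
    using True by (simp add: projector_element_def lookup_tail_sum projector_coeff_def)
  then show ?thesis
    by auto
next
  case False
  define m where "m = n - 1 - k"
  have n: "n = Suc (k + m)" and m: "m \<ge> 1"
    using assms False by (auto simp: m_def)
  \<comment> \<open>Only the last two of the tail sums contain this transposition.\<close>
  have "Poly_Mapping.lookup (projector_element n k) (Transposition.transpose (k + m) (Suc (k + m)))
      = (\<Sum>i\<le>Suc m. if m \<le> i then projector_coeff k i else 0)"
    using m unfolding projector_element_def lookup_sum n
    by (intro sum.cong) (auto simp: lookup_tail_sum transpose_in_tail_increasing_iff)
  also have "\<dots> = (\<Sum>i\<le>m. if i = m then projector_coeff k i else 0) + projector_coeff k (Suc m)"
    by (auto intro!: sum.cong)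
  also have "\<dots> = projector_coeff k m + projector_coeff k (Suc m)"
    by simp
  \<comment> \<open>The two terms have opposite signs and would cancel exactly at
    \<open>m = 0\<close>, that is for \<open>k = n - 1\<close>.\<close>
  also have "\<dots> = projector_coeff k m * (of_nat m / of_nat (Suc m))"
    by (simp add: projector_coeff_def field_simps del: of_nat_Suc) (simp add: algebra_simps)
  also have "\<dots> \<noteq> 0"
    using m by (simp add: projector_coeff_def del: of_nat_Suc)
  finally show ?thesis
    by auto
qed

text \<open>Applied to the unit, the projector returns \<open>projector_element n k\<close> itself,
  a nonzero eigenvector.\<close>

lemma eigenvalues_subset_spectrum:
  assumes "n \<ge> 1"
  shows "eigenvalues n \<subseteq> spectrum (CS n) (t_op n)"
proof
  interpret separable_operator "CS n" "t_op n" "eigenvalues n"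
    using assms by (rule separable_operator_t_op)
  fix r
  assume "r \<in> eigenvalues n"
  then obtain k where k: "r = of_nat k" "k + 2 \<le> n \<or> k = n"
    by (auto simp: eigenvalues_def)
  let ?one = "Poly_Mapping.single \<one>\<^bsub>sym_group n\<^esub> 1 :: (nat \<Rightarrow> nat) \<Rightarrow>\<^sub>0 complex"
  have one: "?one \<in> CS n"
    by (intro single_in_group_algebra monoid.one_closed group.is_monoid sym_group_is_group)
  have "poly_op (projector_poly n k) (t_op n) ?one = projector_element n k"
    using monoid.conv_one_left[OF group.is_monoid[OF sym_group_is_group]
        projector_element_in_CS[of n k]]
      conv_projector_element[OF one, of k] k by auto
  moreover have "poly_op (projector_poly n k) (t_op n) ?one \<in> eigenspace (CS n) (t_op n) r"
    using k one by (intro poly_op_in_eigenspace) (auto simp: eigenvalues_def poly_projector_poly)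
  ultimately show "r \<in> spectrum (CS n) (t_op n)"
    using projector_element_nonzero[OF k(2)] by (auto simp: spectrum_def)
qed

lemma spectral_projector_t_op:
  assumes "n \<ge> 1" "k \<le> n"
  shows "spectral_projector (CS n) (t_op n) (of_nat k)
    (\<lambda>f. conv (sym_group n) f (projector_element n k))"
proof -
  interpret separable_operator "CS n" "t_op n" "eigenvalues n"
    using assms(1) by (rule separable_operator_t_op)
  show ?thesis
    by (rule spectral_projector[of _ "projector_poly n k"])
      (use assms in \<open>auto simp: conv_projector_element eigenvalues_def poly_projector_poly\<close>)
qed

section \<open>The generating series\<close>

lemma scale_eq_single_mult: "scale c f = Poly_Mapping.single 0 c * (f :: 'a :: monoid_add \<Rightarrow>\<^sub>0 complex)"
  unfolding scale_def by (rule mult_map_scale_conv_mult)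

text \<open>Scalars are central although concatenation is not commutative, since the empty
  composition is neutral on both sides.\<close>

lemma single_zero_commute:
  "f * Poly_Mapping.single 0 c = Poly_Mapping.single 0 c * (f :: 'a :: monoid_add \<Rightarrow>\<^sub>0 complex)"
proof -
  have "(\<Sum>x\<in>Poly_Mapping.keys f. Poly_Mapping.single x (Poly_Mapping.lookup f x)) * Poly_Mapping.single 0 c
      = Poly_Mapping.single 0 c * (\<Sum>x\<in>Poly_Mapping.keys f. Poly_Mapping.single x (Poly_Mapping.lookup f x))"
    unfolding sum_distrib_left sum_distrib_right mult_single by (simp add: mult.commute)
  then show ?thesis
    by (simp flip: poly_mapping_eq_sum_single)
qed

lemma scale_mult_left: "scale c f * g = scale c (f * (g :: 'a :: monoid_add \<Rightarrow>\<^sub>0 complex))"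
  by (simp add: scale_eq_single_mult mult.assoc)

lemma scale_mult_right: "f * scale c g = scale c (f * (g :: 'a :: monoid_add \<Rightarrow>\<^sub>0 complex))"
  by (metis scale_eq_single_mult single_zero_commute mult.assoc)

text \<open>The composition \<open>(1, ..., 1, m)\<close>; a part \<open>m = 0\<close> is dropped,
  in accordance with \<open>S 0 = 1\<close>.\<close>

definition hook_comp :: "nat \<Rightarrow> nat \<Rightarrow> composition" where
  "hook_comp j m = Abs_composition (replicate j 1 @ (if m = 0 then [] else [m]))"

lemma Rep_hook_comp: "Rep_composition (hook_comp j m) = replicate j 1 @ (if m = 0 then [] else [m])"
  unfolding hook_comp_def by (subst Abs_composition_inverse) auto

lemma S_power_mult_S: "S 1 ^ j * S m = Poly_Mapping.single (hook_comp j m) 1"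
proof (induction j)
  case 0
  show ?case
    by (simp add: S_def hook_comp_def flip: zero_composition_def)
next
  case (Suc j)
  have "Abs_composition [1] + hook_comp j m = hook_comp (Suc j) m"
    by (auto simp: Rep_composition_inject[symmetric] plus_composition.rep_eq Rep_hook_comp
        Abs_composition_inverse)
  moreover have "S 1 ^ Suc j * S m = Poly_Mapping.single (Abs_composition [1]) 1 * (S 1 ^ j * S m)"
    by (simp add: mult.assoc S_def)
  ultimately show ?case
    by (simp only: Suc mult_single mult_1)
qed

section \<open>Homogeneous components and the map to the descent algebra\<close>

lemma single_in_Sym: "sum_list (Rep_composition I) = n \<Longrightarrow> Poly_Mapping.single I c \<in> Sym n"
  by (simp add: Sym_def)

lemma subspace_Sym: "free_vs.subspace (Sym n)"
  using subspace_supported_on[of "{I. sum_list (Rep_composition I) = n}"]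
  by (simp add: Sym_def subset_iff Ball_def)

lemma S_power_mult_S_in_Sym: "j + m = n \<Longrightarrow> S 1 ^ j * S m \<in> Sym n"
  unfolding S_power_mult_S by (rule single_in_Sym) (auto simp: Rep_hook_comp sum_list_replicate)

lemma to_descent_algebra_eq_sum:
  assumes "finite A" "Poly_Mapping.keys F \<subseteq> A"
  shows "to_descent_algebra n F = (\<Sum>I\<in>A. scale (Poly_Mapping.lookup F I)
     (\<Sum>p | p \<in> carrier (sym_group n) \<and> descent_set n p \<subseteq> partial_sums I. Poly_Mapping.single p 1))"
  unfolding to_descent_algebra_def
  by (rule sum.mono_neutral_left) (use assms in \<open>auto simp: in_keys_iff\<close>)

lemma to_descent_algebra_0 [simp]: "to_descent_algebra n 0 = 0"
  by (simp add: to_descent_algebra_def)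

lemma to_descent_algebra_add:
  "to_descent_algebra n (F + G) = to_descent_algebra n F + to_descent_algebra n G"
proof -
  let ?A = "Poly_Mapping.keys F \<union> Poly_Mapping.keys G"
  have "Poly_Mapping.keys (F + G) \<subseteq> ?A"
    by (rule keys_add)
  then show ?thesis
    by (simp add: to_descent_algebra_eq_sum[of ?A] lookup_add free_vs.scale_left_distrib sum.distrib)
qed

lemma to_descent_algebra_scale:
  "to_descent_algebra n (scale c F) = scale c (to_descent_algebra n F)"
  by (simp add: to_descent_algebra_eq_sum[of "Poly_Mapping.keys F"] subset_iff in_keys_iff
      free_vs.scale_sum_right)

lemma to_descent_algebra_sum:
  "to_descent_algebra n (\<Sum>i\<in>I. F i) = (\<Sum>i\<in>I. to_descent_algebra n (F i))"
  by (induction I rule: infinite_finite_induct) (simp_all add: to_descent_algebra_add)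

lemma partial_sums_hook_comp:
  "partial_sums (hook_comp j m) = (if m = 0 then {1..<j} else {1..j})"
proof -
  have *: "sum_list (take i (replicate j 1 @ xs)) = i" if "i \<le> j" for i and xs :: "nat list"
    using that by (simp add: take_replicate sum_list_replicate)
  show ?thesis
  proof (cases "m = 0")
    case True
    then show ?thesis
      unfolding partial_sums_def Rep_hook_comp using *[of _ "[]"] by force
  next
    case False
    then show ?thesis
      unfolding partial_sums_def Rep_hook_comp using *[of _ "[m]"] by force
  qed
qed

lemma to_descent_algebra_S_power_mult_S:
  assumes "j + m = n"
  shows "to_descent_algebra n (S 1 ^ j * S m) = tail_sum n j"
proof -
  \<comment> \<open>For \<open>m = 0\<close> the partial sums stop at \<open>j - 1 = n - 1\<close>,
    and no descent lies beyond that.\<close>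
  have "descent_set n p \<subseteq> partial_sums (hook_comp j m) \<longleftrightarrow> descent_set n p \<subseteq> {1..j}" for p
    using assms by (auto simp: partial_sums_hook_comp descent_set_def)
  then have "{p. p \<in> carrier (sym_group n) \<and> descent_set n p \<subseteq> partial_sums (hook_comp j m)}
      = tail_increasing n j"
    by (simp add: tail_increasing_iff sym_group_carrier set_eq_iff del: One_nat_def)
  then show ?thesis
    unfolding S_power_mult_S to_descent_algebra_def tail_sum_def by simp
qed

text \<open>The power is homogeneous of degree \<open>j\<close> in \<open>t\<close> and
  \<open>u\<close>, and its coefficients obey Pascal's rule with a sign for each factor
  \<open>t\<close>.\<close>

lemma nth_power_u_minus_t:
  "fps_nth (fps_nth (((var_u - var_t) * const2 F) ^ j) a) b
    = (if a + b = j then scale ((- 1) ^ a * of_nat (j choose a)) (F ^ j) else 0)"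
proof (induction j arbitrary: a b)
  case 0
  show ?case
    by (auto simp: fps_one_nth)
next
  case (Suc j)
  let ?G = "((var_u - var_t) * const2 F) ^ j"
  have nth: "fps_nth (fps_nth (((var_u - var_t) * const2 F) ^ Suc j) a) b
      = (if b = 0 then 0 else F * fps_nth (fps_nth ?G a) (b - 1))
        - (if a = 0 then 0 else F * fps_nth (fps_nth ?G (a - 1)) b)"
    by (simp add: mult.assoc left_diff_distrib var_u_def var_t_def const2_def)
  let ?c = "\<lambda>j a. (- 1) ^ a * of_nat (j choose a) :: complex"
  \<comment> \<open>The guards matter at the border: for \<open>a = 0\<close> the truncated
    \<open>a - 1\<close> would be 0 again and give a spurious term.\<close>
  have pascal: "?c (Suc j) a = (if b = 0 then 0 else ?c j a) - (if a = 0 then 0 else ?c j (a - 1))"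
    if "a + b = Suc j"
    using that by (cases a; cases b) (simp_all add: distrib_left binomial_eq_0)
  show ?case
  proof (cases "a + b = Suc j")
    case True
    have "fps_nth (fps_nth (((var_u - var_t) * const2 F) ^ Suc j) a) b
        = scale (if b = 0 then 0 else ?c j a) (F * F ^ j)
          - scale (if a = 0 then 0 else ?c j (a - 1)) (F * F ^ j)"
      unfolding nth Suc using True by (cases a; cases b) (simp_all add: scale_mult_right)
    also have "\<dots> = scale (?c (Suc j) a) (F ^ Suc j)"
      unfolding pascal[OF True] free_vs.scale_left_diff_distrib power_Suc ..
    finally show ?thesis
      using True by simp
  next
    case False
    then show ?thesis
      unfolding nth Suc by auto
  qed
qed

lemma nth_exp_series2:
  "fps_nth (fps_nth (exp_series2 ((var_u - var_t) * const2 F)) a) b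
    = scale (projector_coeff b a) (F ^ (a + b))"
proof -
  have "scale (1 / fact j) (fps_nth (fps_nth (((var_u - var_t) * const2 F) ^ j) a) b)
      = (if j = a + b then scale (1 / fact j * ((- 1) ^ a * of_nat (j choose a))) (F ^ j) else 0)" for j
    by (simp add: nth_power_u_minus_t)
  then have "fps_nth (fps_nth (exp_series2 ((var_u - var_t) * const2 F)) a) b
      = Sum_any (\<lambda>j. if j = a + b then scale (1 / fact j * ((- 1) ^ a * of_nat (j choose a))) (F ^ j) else 0)"
    by (simp only: exp_series2_def fps_nth_Abs_fps)
  also have "\<dots> = scale (1 / fact (a + b) * ((- 1) ^ a * of_nat ((a + b) choose a))) (F ^ (a + b))"
    by simp
  also have "1 / fact (a + b) * ((- 1) ^ a * of_nat ((a + b) choose a)) = projector_coeff b a"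
    by (simp add: projector_coeff_def binomial_fact)
  finally show ?thesis .
qed

text \<open>\<open>S_series_t\<close> is constant in \<open>u\<close>, so \<open>u^k\<close> comes
  from the exponential alone, and only the exponent \<open>n - k\<close> of \<open>t\<close> is
  split between the two factors.\<close>

lemma D_series_nth:
  assumes "D_series D = exp_series2 ((var_u - var_t) * const2 (S 1)) * S_series_t" "k \<le> n"
  shows "D n k = (\<Sum>i\<le>n - k. scale (projector_coeff k i) (S 1 ^ (k + i) * S (n - k - i)))"
proof -
  have "D n k = fps_nth (fps_nth (D_series D) (n - k)) k"
    using assms(2) by (simp add: D_series_def)
  also have "\<dots> = (\<Sum>i\<le>n - k. scale (projector_coeff k i) (S 1 ^ (k + i) * S (n - k - i)))"
    unfolding assms(1)
    by (simp add: fps_mult_nth[of "exp_series2 _"] fps_sum_nth S_series_t_def nth_exp_series2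
        scale_mult_left atLeast0AtMost add.commute)
  finally show ?thesis .
qed

text \<open>The coefficients are those of the two-variable exponential at \<open>u = 0\<close>,
  which matches the series of the \<open>D m 0\<close>.\<close>

lemma nth_exp_series_minus_X:
  "fps_nth (exp_series (- (fps_X * fps_const F))) a = scale (projector_coeff 0 a) (F ^ a)"
proof -
  have nth_power: "fps_nth ((- (fps_X * fps_const F)) ^ j) a = (if a = j then scale ((- 1) ^ j) (F ^ j) else 0)"
    for j a
  proof (induction j arbitrary: a)
    case (Suc j)
    have "fps_nth ((- (fps_X * fps_const F)) ^ Suc j) a
        = (if a = 0 then 0 else - (F * fps_nth ((- (fps_X * fps_const F)) ^ j) (a - 1)))"
      by (simp add: mult.assoc)
    then show ?case
      unfolding Suc by (auto simp: scale_mult_right)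
  qed (simp add: fps_one_nth)
  have "scale (1 / fact j) (fps_nth ((- (fps_X * fps_const F)) ^ j) a)
      = (if j = a then scale (1 / fact j * (- 1) ^ j) (F ^ j) else 0)" for j
    by (simp add: nth_power)
  then have "fps_nth (exp_series (- (fps_X * fps_const F))) a
      = Sum_any (\<lambda>j. if j = a then scale (1 / fact j * (- 1) ^ j) (F ^ j) else 0)"
    by (simp only: exp_series_def fps_nth_Abs_fps)
  then show ?thesis
    by (simp add: projector_coeff_def)
qed

theorem mainTheorem6:
  fixes n :: nat and D :: "nat \<Rightarrow> nat \<Rightarrow> sym"
  assumes "n \<ge> 1"
    and "D_series D = exp_series2 ((var_u - var_t) * const2 (S 1)) * S_series_t"
  shows "linear_op (CS n) (t_op n)
    \<and> diagonalizable (CS n) (t_op n)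
    \<and> spectrum (CS n) (t_op n) = of_nat ` ({k. k + 2 \<le> n} \<union> {n})
    \<and> minimal_polynomial (CS n) (t_op n)
        ([:- of_nat n, 1:] * (\<Prod>k | k + 2 \<le> n. [:- of_nat k, 1:]))
    \<and> S 1 * S (n - 1) \<in> Sym n
    \<and> to_descent_algebra n (S 1 * S (n - 1)) = tau n
    \<and> (\<forall>k\<le>n. D n k \<in> Sym n
         \<and> spectral_projector (CS n) (t_op n) (of_nat k)
             (\<lambda>f. conv (sym_group n) f (to_descent_algebra n (D n k))))
    \<and> spectral_projector (CS n) (t_op n) 0
         (\<lambda>f. conv (sym_group n) f (to_descent_algebra n (D n 0)))
    \<and> (\<lambda>f. conv (sym_group n) f (to_descent_algebra n (D n 0))) ` CS n
         = {f \<in> CS n. t_op n f = 0}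
    \<and> Abs_fps (\<lambda>m. D m 0) = exp_series (- (fps_X * fps_const (S 1))) * Abs_fps S"
proof -
  interpret separable_operator "CS n" "t_op n" "eigenvalues n"
    using assms(1) by (rule separable_operator_t_op)
  note D = D_series_nth[OF assms(2)]
  have Sym: "D n k \<in> Sym n" if "k \<le> n" for k
    unfolding D[OF that] using that
    by (intro free_vs.subspace_sum free_vs.subspace_scale subspace_Sym S_power_mult_S_in_Sym) auto
  have "to_descent_algebra n (D n k) = projector_element n k" if "k \<le> n" for k
    unfolding D[OF that] projector_element_def to_descent_algebra_sum to_descent_algebra_scale
    using that by (intro sum.cong) (simp_all add: to_descent_algebra_S_power_mult_S del: One_nat_def)
  then have projector: "spectral_projector (CS n) (t_op n) (of_nat k)
      (\<lambda>f. conv (sym_group n) f (to_descent_algebra n (D n k)))" if "k \<le> n" for k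
    using spectral_projector_t_op[OF assms(1) that] that by simp
  from projector[of 0] have projector_0: "spectral_projector (CS n) (t_op n) 0
      (\<lambda>f. conv (sym_group n) f (to_descent_algebra n (D n 0)))"
    by simp
  then have kernel: "(\<lambda>f. conv (sym_group n) f (to_descent_algebra n (D n 0))) ` CS n
      = {f \<in> CS n. t_op n f = 0}"
    by (simp add: spectral_projector_def eigenspace_def)
  have spectrum: "spectrum (CS n) (t_op n) = eigenvalues n"
    using spectrum_subset eigenvalues_subset_spectrum[OF assms(1)] by blast
  \<comment> \<open>The formula for \<open>D\<close> is available in every degree, not only in the
    fixed \<open>n\<close>, so coefficients can be compared.\<close>
  have series: "Abs_fps (\<lambda>m. D m 0) = exp_series (- (fps_X * fps_const (S 1))) * Abs_fps S"
    by (rule fps_ext)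
      (simp add: D fps_mult_nth nth_exp_series_minus_X scale_mult_left atLeast0AtMost)
  show ?thesis
    using linear diagonalizable spectrum[unfolded eigenvalues_def]
      minimal_polynomial[OF equalityD2[OF spectrum], unfolded prod_eigenvalues]
      S_power_mult_S_in_Sym[of 1 "n - 1" n] to_descent_algebra_S_power_mult_S[of 1 "n - 1" n]
      tail_sum_1[OF assms(1)] Sym projector projector_0 kernel series assms(1)
    by (simp del: mult_pCons_left)
qed

end
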